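(* Let $N\ge 1$ and $n\ge 0$ be integers. For each $k=1,\dots,n$ let $b_k=(b_k^1,\dots,b_k^N)\in\{0,1\}^N$, let $h_{b_k}$ be a nonzero real number, and set $$P_{b_k}:=\bigotimes_{i=1}^N\sigma_{b_k^i},\qquad H_{b_k}:=h_{b_k}P_{b_k}+|h_{b_k}|\,I$$ as operators on $(\mathbb{C}^2)^{\otimes N}$. Then the operators $H_{b_1},\dots,H_{b_n}$ commute pairwise, and the product $H_{b_n}\cdots H_{b_1}$ is Hermitian and positive semidefinite; in particular $\langle\alpha|H_{b_n}\cdots H_{b_1}|\alpha\rangle\ge 0$ for every unit vector $|\alpha\rangle\in(\mathbb{C}^2)^{\otimes N}$. Moreover, for every such $|\alpha\rangle$, with the state $|\psi\rangle$ and the unitaries $U_1,\dots,U_n$ defined in the context, $$\langle\psi|U_n\cdots U_1|\psi\rangle=\frac{\langle\alpha|H_{b_n}\cdots H_{b_1}|\alpha\rangle}{2^n\,|h_{b_n}\cdots h_{b_1}|}.$$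
   Context: $\sigma_0=I$ is the $2\times2$ identity and $\sigma_1=\sigma_x$ is the Pauli $X$ matrix. For $n=0$ empty products of operators are the identity and empty products of scalars are $1$. Consider the Hilbert space $A\otimes B_1\otimes\cdots\otimes B_n$, where $A=(\mathbb{C}^2)^{\otimes N}$ and each $B_k$ is a copy of $\mathbb{C}^2$ with orthonormal basis $|0\rangle,|1\rangle$. Set $|+\rangle:=\tfrac{1}{\sqrt2}(|0\rangle+|1\rangle)$ and $$|\psi\rangle:=|\alpha\rangle_A\otimes|+\rangle_{B_1}\otimes\cdots\otimes|+\rangle_{B_n}.$$ For each $k$, $U_k$ is the controlled unitary acting on $A$ and $B_k$ (and trivially on the other factors) given by $$U_k\,|v\rangle_A|0\rangle_{B_k}=|v\rangle_A|0\rangle_{B_k},\qquad U_k\,|v\rangle_A|1\rangle_{B_k}=\left(\operatorname{sgn}(h_{b_k})P_{b_k}|v\rangle_A\right)|1\rangle_{B_k}$$ for all $|v\rangle\in A$. *)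

theory Defs
  imports "Jordan_Normal_Form.Schur_Decomposition"
begin

section \<open>Tensor products\<close>

text \<open>Kronecker products in the usual ordering: the basis vector
  \<open>e\<^sub>i \<otimes> e\<^sub>j\<close> of \<open>\<complex>\<^sup>m \<otimes> \<complex>\<^sup>n\<close> is the basis vector number
  \<open>i * n + j\<close> of \<open>\<complex>\<^sup>m\<^sup>n\<close>.\<close>

definition kron_vec :: "complex vec \<Rightarrow> complex vec \<Rightarrow> complex vec" where
  "kron_vec v w = vec (dim_vec v * dim_vec w)
     (\<lambda>i. v $ (i div dim_vec w) * w $ (i mod dim_vec w))"

definition kron_mat :: "complex mat \<Rightarrow> complex mat \<Rightarrow> complex mat" where
  "kron_mat A B = mat (dim_row A * dim_row B) (dim_col A * dim_col B)
     (\<lambda>(i, j). A $$ (i div dim_row B, j div dim_col B) * B $$ (i mod dim_row B, j mod dim_col B))"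

text \<open>\<open>f 1 \<otimes> \<dots> \<otimes> f n\<close>; the empty product is the scalar 1 in \<open>\<complex>\<^sup>1\<close>, so that
  \<open>n\<close> qubits live in \<open>carrier_vec (2 ^ n)\<close>.\<close>

fun tensor_vec :: "(nat \<Rightarrow> complex vec) \<Rightarrow> nat \<Rightarrow> complex vec" where
  "tensor_vec f 0 = vec 1 (\<lambda>_. 1)"
| "tensor_vec f (Suc n) = kron_vec (tensor_vec f n) (f (Suc n))"

fun tensor_mat :: "(nat \<Rightarrow> complex mat) \<Rightarrow> nat \<Rightarrow> complex mat" where
  "tensor_mat f 0 = 1\<^sub>m 1"
| "tensor_mat f (Suc n) = kron_mat (tensor_mat f n) (f (Suc n))"

section \<open>Operators\<close>

text \<open>\<open>F n * \<dots> * F 1\<close>, as operators on \<open>\<complex>\<^sup>d\<close>.\<close>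

fun op_prod :: "nat \<Rightarrow> (nat \<Rightarrow> complex mat) \<Rightarrow> nat \<Rightarrow> complex mat" where
  "op_prod d F 0 = 1\<^sub>m d"
| "op_prod d F (Suc n) = F (Suc n) * op_prod d F n"

text \<open>\<open>\<langle>u|v\<rangle>\<close>: conjugate-linear in the first argument, whereas \<open>\<bullet>c\<close> conjugates its second one.\<close>

definition braket :: "complex vec \<Rightarrow> complex vec \<Rightarrow> complex" where
  "braket u v = v \<bullet>c u"

definition hermitian_mat :: "complex mat \<Rightarrow> bool" where
  "hermitian_mat A \<longleftrightarrow> mat_adjoint A = A"

text \<open>The order on \<^typ>\<open>complex\<close> is that of \<^theory>\<open>HOL-Library.Complex_Order\<close>: \<open>0 \<le> z\<close> means that
  \<open>z\<close> is real and nonnegative.\<close>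

definition positive_semidefinite :: "complex mat \<Rightarrow> bool" where
  "positive_semidefinite A \<longleftrightarrow>
     hermitian_mat A \<and> (\<forall>v \<in> carrier_vec (dim_row A). 0 \<le> braket v (A *\<^sub>v v))"

section \<open>Qubits and Pauli strings\<close>

definition ket0 :: "complex vec" where
  "ket0 = unit_vec 2 0"

definition ket1 :: "complex vec" where
  "ket1 = unit_vec 2 1"

definition ket_plus :: "complex vec" where
  "ket_plus = complex_of_real (1 / sqrt 2) \<cdot>\<^sub>v (ket0 + ket1)"

text \<open>Only the indices 0 and 1 are meaningful.\<close>

definition sigma :: "nat \<Rightarrow> complex mat" where
  "sigma m = (if m = 0 then 1\<^sub>m 2 else mat_of_rows_list 2 [[0, 1], [1, 0]])"

definition pauli_string :: "nat \<Rightarrow> (nat \<Rightarrow> nat) \<Rightarrow> complex mat" where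
  "pauli_string N b = tensor_mat (\<lambda>i. sigma (b i)) N"

definition ham_term :: "nat \<Rightarrow> (nat \<Rightarrow> nat) \<Rightarrow> real \<Rightarrow> complex mat" where
  "ham_term N b h =
     complex_of_real h \<cdot>\<^sub>m pauli_string N b + complex_of_real \<bar>h\<bar> \<cdot>\<^sub>m 1\<^sub>m (2 ^ N)"

section \<open>The controlled operators\<close>

text \<open>\<open>|\<alpha>\<rangle> \<otimes> |+\<rangle> \<otimes> \<dots> \<otimes> |+\<rangle>\<close> with \<open>n\<close> ancilla qubits.\<close>

definition psi_state :: "nat \<Rightarrow> complex vec \<Rightarrow> complex vec" where
  "psi_state n \<alpha> = kron_vec \<alpha> (tensor_vec (\<lambda>_. ket_plus) n)"

text \<open>\<open>U\<close> applies \<open>Q\<close> to the first factor \<open>A = \<complex>\<^sup>a\<close> of \<open>A \<otimes> B\<^sub>1 \<otimes> \<dots> \<otimes> B\<^sub>n\<close>, controlled by the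
  qubit \<open>B\<^sub>k\<close>. The vectors \<open>w j\<close> with \<open>j \<noteq> k\<close> are arbitrary, i.e. \<open>U\<close> acts trivially on the
  other qubits. As product vectors span the space, this determines \<open>U\<close>; it exists by
  lemma \<open>controlled_op_exists\<close> below.\<close>

definition is_controlled_op :: "nat \<Rightarrow> nat \<Rightarrow> complex mat \<Rightarrow> nat \<Rightarrow> complex mat \<Rightarrow> bool" where
  "is_controlled_op a n Q k U \<longleftrightarrow>
     U \<in> carrier_mat (a * 2 ^ n) (a * 2 ^ n) \<and>
     (\<forall>v w. v \<in> carrier_vec a \<longrightarrow> (\<forall>j \<in> {1..n}. w j \<in> carrier_vec 2) \<longrightarrow>
        U *\<^sub>v kron_vec v (tensor_vec (w(k := ket0)) n)
          = kron_vec v (tensor_vec (w(k := ket0)) n) \<and>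
        U *\<^sub>v kron_vec v (tensor_vec (w(k := ket1)) n)
          = kron_vec (Q *\<^sub>v v) (tensor_vec (w(k := ket1)) n))"

lemma kron_mat_carrier:
  "A \<in> carrier_mat r c \<Longrightarrow> B \<in> carrier_mat r' c' \<Longrightarrow> kron_mat A B \<in> carrier_mat (r * r') (c * c')"
  by (auto simp: kron_mat_def)

lemma kron_vec_carrier:
  "v \<in> carrier_vec r \<Longrightarrow> w \<in> carrier_vec r' \<Longrightarrow> kron_vec v w \<in> carrier_vec (r * r')"
  by (auto simp: kron_vec_def)

lemma tensor_mat_carrier:
  "(\<And>j. j \<in> {1..n} \<Longrightarrow> f j \<in> carrier_mat 2 2) \<Longrightarrow> tensor_mat f n \<in> carrier_mat (2 ^ n) (2 ^ n)"
proof (induction n)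
  case (Suc n)
  have "tensor_mat f n \<in> carrier_mat (2 ^ n) (2 ^ n)" "f (Suc n) \<in> carrier_mat 2 2"
    using Suc by auto
  from kron_mat_carrier[OF this] show ?case by (simp add: mult.commute)
qed simp

lemma tensor_vec_carrier:
  "(\<And>j. j \<in> {1..n} \<Longrightarrow> f j \<in> carrier_vec 2) \<Longrightarrow> tensor_vec f n \<in> carrier_vec (2 ^ n)"
proof (induction n)
  case (Suc n)
  have "tensor_vec f n \<in> carrier_vec (2 ^ n)" "f (Suc n) \<in> carrier_vec 2"
    using Suc by auto
  from kron_vec_carrier[OF this] show ?case by (simp add: mult.commute)
qed simp

lemma sum_div_mod:
  fixes f g :: "nat \<Rightarrow> complex"
  shows "(\<Sum>j<m * n. f (j div n) * g (j mod n)) = (\<Sum>i<m. f i) * (\<Sum>j<n. g j)"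
proof -
  have "(\<Sum>j<m * n. f (j div n) * g (j mod n))
      = (\<Sum>i<m. \<Sum>j\<in>{i * n..<i * n + n}. f (j div n) * g (j mod n))"
    by (simp only: sum.nat_group)
  also have "\<dots> = (\<Sum>i<m. \<Sum>j<n. f i * g j)"
  proof (rule sum.cong[OF refl])
    fix i
    have "(\<Sum>j\<in>{i * n..<i * n + n}. f (j div n) * g (j mod n))
        = (\<Sum>j\<in>{0..<n}. f ((j + i * n) div n) * g ((j + i * n) mod n))"
      using sum.shift_bounds_nat_ivl[of "\<lambda>j. f (j div n) * g (j mod n)" 0 "i * n" n]
      by (simp add: add.commute)
    also have "\<dots> = (\<Sum>j<n. f i * g j)"
      by (rule sum.cong) auto
    finally show "(\<Sum>j\<in>{i * n..<i * n + n}. f (j div n) * g (j mod n)) = (\<Sum>j<n. f i * g j)" .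
  qed
  also have "\<dots> = (\<Sum>i<m. f i) * (\<Sum>j<n. g j)"
    by (simp add: sum_product)
  finally show ?thesis .
qed

lemma kron_mult_mat_vec:
  assumes "A \<in> carrier_mat r c" "B \<in> carrier_mat r' c'" "v \<in> carrier_vec c" "w \<in> carrier_vec c'"
  shows "kron_mat A B *\<^sub>v kron_vec v w = kron_vec (A *\<^sub>v v) (B *\<^sub>v w)"
proof (rule eq_vecI)
  show "dim_vec (kron_mat A B *\<^sub>v kron_vec v w) = dim_vec (kron_vec (A *\<^sub>v v) (B *\<^sub>v w))"
    using assms by (simp add: kron_mat_def kron_vec_def)
next
  fix i assume "i < dim_vec (kron_vec (A *\<^sub>v v) (B *\<^sub>v w))"
  then have i: "i < r * r'" using assms by (simp add: kron_vec_def)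
  then have "r' > 0" by (cases r') auto
  then have i2: "i mod r' < r'" and i1: "i div r' < r"
    using i by (auto simp: less_mult_imp_div_less)
  have "(kron_mat A B *\<^sub>v kron_vec v w) $ i
      = (\<Sum>j<c * c'. (A $$ (i div r', j div c') * v $ (j div c'))
                    * (B $$ (i mod r', j mod c') * w $ (j mod c')))"
    using assms i
    by (auto simp: kron_mat_def kron_vec_def scalar_prod_def lessThan_atLeast0 intro!: sum.cong)
  also have "\<dots> = (\<Sum>j<c. A $$ (i div r', j) * v $ j) * (\<Sum>j<c'. B $$ (i mod r', j) * w $ j)"
    by (rule sum_div_mod)
  also have "\<dots> = kron_vec (A *\<^sub>v v) (B *\<^sub>v w) $ i"
    using assms i i1 i2 by (simp add: kron_vec_def scalar_prod_def lessThan_atLeast0)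
  finally show "(kron_mat A B *\<^sub>v kron_vec v w) $ i = kron_vec (A *\<^sub>v v) (B *\<^sub>v w) $ i" .
qed

lemma tensor_mult_mat_vec:
  assumes "\<And>j. j \<in> {1..n} \<Longrightarrow> f j \<in> carrier_mat 2 2" "\<And>j. j \<in> {1..n} \<Longrightarrow> w j \<in> carrier_vec 2"
  shows "tensor_mat f n *\<^sub>v tensor_vec w n = tensor_vec (\<lambda>j. f j *\<^sub>v w j) n"
  using assms
proof (induction n)
  case 0
  show ?case by simp
next
  case (Suc n)
  have "tensor_mat f n \<in> carrier_mat (2 ^ n) (2 ^ n)" "tensor_vec w n \<in> carrier_vec (2 ^ n)"
    using Suc.prems by (auto intro!: tensor_mat_carrier tensor_vec_carrier)
  moreover have "f (Suc n) \<in> carrier_mat 2 2" "w (Suc n) \<in> carrier_vec 2"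
    using Suc.prems by auto
  moreover have "tensor_mat f n *\<^sub>v tensor_vec w n = tensor_vec (\<lambda>j. f j *\<^sub>v w j) n"
    using Suc by auto
  ultimately show ?case by (simp add: kron_mult_mat_vec)
qed

lemma tensor_vec_cong:
  "(\<And>j. j \<in> {1..n} \<Longrightarrow> f j = g j) \<Longrightarrow> tensor_vec f n = tensor_vec g n"
  by (induction n) auto

lemma kron_vec_zero:
  "kron_vec v (0\<^sub>v m) = 0\<^sub>v (dim_vec v * m)" "kron_vec (0\<^sub>v m) v = 0\<^sub>v (m * dim_vec v)"
proof -
  show "kron_vec v (0\<^sub>v m) = 0\<^sub>v (dim_vec v * m)"
    by (rule eq_vecI) (simp_all add: kron_vec_def, metis less_nat_zero_code mod_less_divisor mult_is_0 neq0_conv index_zero_vec(1))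
  show "kron_vec (0\<^sub>v m) v = 0\<^sub>v (m * dim_vec v)"
    by (rule eq_vecI) (simp_all add: kron_vec_def less_mult_imp_div_less)
qed

lemma tensor_vec_zero:
  assumes "\<And>j. j \<in> {1..n} \<Longrightarrow> f j \<in> carrier_vec 2" "k \<in> {1..n}" "f k = 0\<^sub>v 2"
  shows "tensor_vec f n = 0\<^sub>v (2 ^ n)"
  using assms
proof (induction n)
  case (Suc n)
  have c: "tensor_vec f n \<in> carrier_vec (2 ^ n)" "f (Suc n) \<in> carrier_vec 2"
    using Suc.prems by (auto intro!: tensor_vec_carrier)
  show ?case
  proof (cases "k = Suc n")
    case True
    then show ?thesis using Suc.prems c by (simp add: kron_vec_zero mult.commute)
  next
    case False
    then have "tensor_vec f n = 0\<^sub>v (2 ^ n)" using Suc by auto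
    then show ?thesis using c by (simp add: kron_vec_zero mult.commute)
  qed
qed simp

definition proj0 :: "complex mat" where
  "proj0 = mat 2 2 (\<lambda>(i, j). if i = 0 \<and> j = 0 then 1 else 0)"

definition proj1 :: "complex mat" where
  "proj1 = mat 2 2 (\<lambda>(i, j). if i = 1 \<and> j = 1 then 1 else 0)"

lemma ket_carrier: "ket0 \<in> carrier_vec 2" "ket1 \<in> carrier_vec 2"
  by (simp_all add: ket0_def ket1_def)

lemma proj_carrier: "proj0 \<in> carrier_mat 2 2" "proj1 \<in> carrier_mat 2 2"
  by (simp_all add: proj0_def proj1_def)

lemma proj_ket:
  "proj0 *\<^sub>v ket0 = ket0" "proj0 *\<^sub>v ket1 = 0\<^sub>v 2"
  "proj1 *\<^sub>v ket0 = 0\<^sub>v 2" "proj1 *\<^sub>v ket1 = ket1"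
  by (rule eq_vecI;
      auto simp: proj0_def proj1_def ket0_def ket1_def unit_vec_def scalar_prod_def sum.atLeast0_lessThan_Suc numeral_2_eq_2)+

text \<open>The operator \<open>I \<otimes> |0\<rangle>\<langle>0|\<^sub>k + Q \<otimes> |1\<rangle>\<langle>1|\<^sub>k\<close> is controlled.\<close>

lemma controlled_op_exists:
  assumes Q: "Q \<in> carrier_mat a a" and k: "k \<in> {1..n}"
  shows "\<exists>U. is_controlled_op a n Q k U"
proof -
  define T0 where "T0 = tensor_mat ((\<lambda>_. 1\<^sub>m 2)(k := proj0)) n"
  define T1 where "T1 = tensor_mat ((\<lambda>_. 1\<^sub>m 2)(k := proj1)) n"
  define U where "U = kron_mat (1\<^sub>m a) T0 + kron_mat Q T1"
  have T: "T0 \<in> carrier_mat (2 ^ n) (2 ^ n)" "T1 \<in> carrier_mat (2 ^ n) (2 ^ n)"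
    unfolding T0_def T1_def by (intro tensor_mat_carrier; simp add: proj_carrier)+
  have K: "kron_mat (1\<^sub>m a) T0 \<in> carrier_mat (a * 2 ^ n) (a * 2 ^ n)"
    "kron_mat Q T1 \<in> carrier_mat (a * 2 ^ n) (a * 2 ^ n)"
    using Q T by (auto intro!: kron_mat_carrier)
  have act: "U *\<^sub>v kron_vec v x = kron_vec v (T0 *\<^sub>v x) + kron_vec (Q *\<^sub>v v) (T1 *\<^sub>v x)"
    if "v \<in> carrier_vec a" "x \<in> carrier_vec (2 ^ n)" for v x
  proof -
    have "U *\<^sub>v kron_vec v x = kron_mat (1\<^sub>m a) T0 *\<^sub>v kron_vec v x + kron_mat Q T1 *\<^sub>v kron_vec v x"
      unfolding U_def by (rule add_mult_distrib_mat_vec[OF K kron_vec_carrier[OF that]])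
    then show ?thesis
      using that T Q by (simp add: kron_mult_mat_vec[of _ a a _ "2 ^ n" "2 ^ n"])
  qed
  have "is_controlled_op a n Q k U"
    unfolding is_controlled_op_def
  proof (intro conjI allI impI)
    show "U \<in> carrier_mat (a * 2 ^ n) (a * 2 ^ n)" unfolding U_def using K by simp
    fix v :: "complex vec" and w :: "nat \<Rightarrow> complex vec"
    assume v: "v \<in> carrier_vec a" and w: "\<forall>j\<in>{1..n}. w j \<in> carrier_vec 2"
    let ?x0 = "tensor_vec (w(k := ket0)) n" and ?x1 = "tensor_vec (w(k := ket1)) n"
    have x: "?x0 \<in> carrier_vec (2 ^ n)" "?x1 \<in> carrier_vec (2 ^ n)"
      using w by (auto intro!: tensor_vec_carrier simp: ket_carrier)
    have gen: "tensor_mat ((\<lambda>_. 1\<^sub>m 2)(k := p)) n *\<^sub>v tensor_vec (w(k := t)) n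
        = tensor_vec (w(k := p *\<^sub>v t)) n"
      if "p \<in> carrier_mat 2 2" "t \<in> carrier_vec 2" for p t
    proof -
      have "tensor_mat ((\<lambda>_. 1\<^sub>m 2)(k := p)) n *\<^sub>v tensor_vec (w(k := t)) n
        = tensor_vec (\<lambda>j. ((\<lambda>_. 1\<^sub>m 2)(k := p)) j *\<^sub>v (w(k := t)) j) n"
        by (rule tensor_mult_mat_vec) (use that w in auto)
      also have "\<dots> = tensor_vec (w(k := p *\<^sub>v t)) n"
        by (rule tensor_vec_cong) (use w in auto)
      finally show ?thesis .
    qed
    have z: "tensor_vec (w(k := 0\<^sub>v 2)) n = 0\<^sub>v (2 ^ n)"
      by (rule tensor_vec_zero[OF _ k]) (use w in auto)
    have v0: "kron_vec v x + 0\<^sub>v (a * 2 ^ n) = kron_vec v x" 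
      "0\<^sub>v (a * 2 ^ n) + kron_vec v x = kron_vec v x"
      if "v \<in> carrier_vec a" "x \<in> carrier_vec (2 ^ n)" for v x
      using kron_vec_carrier[OF that] by auto
    have Qv: "Q *\<^sub>v v \<in> carrier_vec a" using Q v by simp
    show "U *\<^sub>v kron_vec v ?x0 = kron_vec v ?x0"
      using act[OF v x(1)] v Q Qv x
      by (simp add: T0_def T1_def gen proj_carrier ket_carrier proj_ket z kron_vec_zero v0 carrier_vecD del: dim_mult_mat_vec)
    show "U *\<^sub>v kron_vec v ?x1 = kron_vec (Q *\<^sub>v v) ?x1"
      using act[OF v x(2)] v Q Qv x
      by (simp add: T0_def T1_def gen proj_carrier ket_carrier proj_ket z kron_vec_zero v0 carrier_vecD del: dim_mult_mat_vec)
  qed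
  then show ?thesis by blast
qed

end

theory Submission
  imports Defs
begin

text \<open>A commuting product \<open>T\<close> of the \<open>H\<^sub>k\<close> is Hermitian and satisfies \<open>T * T = c \<cdot> T\<close> with
  \<open>c = \<Prod>k. 2 \<bar>h\<^sub>k\<bar> > 0\<close>, because \<open>H\<^sub>k * H\<^sub>k = 2 \<bar>h\<^sub>k\<bar> \<cdot> H\<^sub>k\<close>; hence \<open>\<langle>v|T v\<rangle> = \<langle>T v|T v\<rangle> / c \<ge> 0\<close>.
  Averaging over the ancilla in the state \<open>|+\<rangle>\<close> turns a controlled \<open>Q\<close> into \<open>(I + Q) / 2\<close>, and
  \<open>I + sgn h\<^sub>k P\<^sub>k = H\<^sub>k / \<bar>h\<^sub>k\<bar>\<close>.\<close>

section \<open>Hermitian matrices and their tensor products\<close>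

text \<open>Reduces \<open>mat_adjoint\<close>, which is built from conjugated columns taken as
  rows, to entries, so that later Hermiticity proofs become index computations.\<close>

lemma hermitian_mat_iff:
  assumes "A \<in> carrier_mat d d"
  shows "hermitian_mat A \<longleftrightarrow> (\<forall>i<d. \<forall>j<d. cnj (A $$ (j, i)) = A $$ (i, j))"
proof -
  have c: "mat_adjoint A \<in> carrier_mat d d"
    and e: "\<And>i j. i < d \<Longrightarrow> j < d \<Longrightarrow> mat_adjoint A $$ (i, j) = cnj (A $$ (j, i))"
    using assms by (auto simp: mat_adjoint_def mat_of_rows_def)
  show ?thesis
  proof
    assume "hermitian_mat A"
    then show "\<forall>i<d. \<forall>j<d. cnj (A $$ (j, i)) = A $$ (i, j)"
      using e unfolding hermitian_mat_def by metis
  next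
    assume "\<forall>i<d. \<forall>j<d. cnj (A $$ (j, i)) = A $$ (i, j)"
    then have "mat_adjoint A = A"
      using assms c e by (intro eq_matI) auto
    then show "hermitian_mat A" by (simp add: hermitian_mat_def)
  qed
qed

lemma hermitian_one_mat: "hermitian_mat (1\<^sub>m d)"
  by (subst hermitian_mat_iff[of _ d]) auto

lemma hermitian_kron_mat:
  assumes "A \<in> carrier_mat r r" "B \<in> carrier_mat s s" "hermitian_mat A" "hermitian_mat B"
  shows "hermitian_mat (kron_mat A B)"
proof (subst hermitian_mat_iff[OF kron_mat_carrier[OF assms(1,2)]], intro allI impI)
  fix i j assume ij: "i < r * s" "j < r * s"
  \<comment> \<open>An index below \<open>r * s\<close> rules out \<open>s = 0\<close>, so that
    remainders modulo \<open>s\<close> are valid indices of \<open>B\<close>.\<close>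
  then have s: "s > 0" by (cases s) auto
  have d: "i div s < r" "j div s < r" "i mod s < s" "j mod s < s"
    using ij s by (auto simp: less_mult_imp_div_less)
  have "cnj (A $$ (j div s, i div s)) = A $$ (i div s, j div s)"
    "cnj (B $$ (j mod s, i mod s)) = B $$ (i mod s, j mod s)"
    using assms(3,4) d hermitian_mat_iff[OF assms(1)] hermitian_mat_iff[OF assms(2)] by metis+
  then show "cnj (kron_mat A B $$ (j, i)) = kron_mat A B $$ (i, j)"
    using ij assms(1,2) by (simp add: kron_mat_def)
qed

lemma hermitian_tensor_mat:
  assumes "\<And>j. j \<in> {1..n} \<Longrightarrow> f j \<in> carrier_mat 2 2"
    and "\<And>j. j \<in> {1..n} \<Longrightarrow> hermitian_mat (f j)"
  shows "hermitian_mat (tensor_mat f n)"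
  using assms
proof (induction n)
  case 0
  show ?case by (simp add: hermitian_one_mat)
next
  case (Suc n)
  have "hermitian_mat (tensor_mat f n)" using Suc by auto
  with Suc.prems show ?case
    by (auto intro!: hermitian_kron_mat[of _ "2 ^ n" _ 2] tensor_mat_carrier)
qed

section \<open>Products of Kronecker products\<close>

text \<open>The mixed-product rule: the summation index \<open>k\<close> encodes the pair
  \<open>(k div c', k mod c')\<close>, each summand splits accordingly, and
  \<open>sum_div_mod\<close> turns the sum into a product of two sums.\<close>

lemma kron_mat_mult:
  assumes "A \<in> carrier_mat r c" "B \<in> carrier_mat r' c'"
    and "C \<in> carrier_mat c e" "D \<in> carrier_mat c' e'"
  shows "kron_mat A B * kron_mat C D = kron_mat (A * C) (B * D)"
proof (rule eq_matI)
  fix i j assume "i < dim_row (kron_mat (A * C) (B * D))" "j < dim_col (kron_mat (A * C) (B * D))"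
  then have ij: "i < r * r'" "j < e * e'" using assms by (auto simp: kron_mat_def)
  then have "r' > 0" "e' > 0" by (auto intro: gr0I)
  then have d: "i div r' < r" "i mod r' < r'" "j div e' < e" "j mod e' < e'"
    using ij by (auto simp: less_mult_imp_div_less)
  have "(kron_mat A B * kron_mat C D) $$ (i, j)
      = (\<Sum>k<c * c'. (A $$ (i div r', k div c') * C $$ (k div c', j div e'))
                    * (B $$ (i mod r', k mod c') * D $$ (k mod c', j mod e')))"
    using assms ij
    by (auto simp: kron_mat_def scalar_prod_def lessThan_atLeast0 intro!: sum.cong)
  also have "\<dots> = (\<Sum>k<c. A $$ (i div r', k) * C $$ (k, j div e'))
                 * (\<Sum>k<c'. B $$ (i mod r', k) * D $$ (k, j mod e'))"
    by (rule sum_div_mod)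
  also have "\<dots> = kron_mat (A * C) (B * D) $$ (i, j)"
    using assms ij d by (simp add: kron_mat_def scalar_prod_def lessThan_atLeast0)
  finally show "(kron_mat A B * kron_mat C D) $$ (i, j) = kron_mat (A * C) (B * D) $$ (i, j)" .
qed (use assms in \<open>auto simp: kron_mat_def\<close>)

lemma tensor_mat_mult:
  assumes "\<And>j. j \<in> {1..n} \<Longrightarrow> f j \<in> carrier_mat 2 2"
    and "\<And>j. j \<in> {1..n} \<Longrightarrow> g j \<in> carrier_mat 2 2"
  shows "tensor_mat f n * tensor_mat g n = tensor_mat (\<lambda>j. f j * g j) n"
  using assms
proof (induction n)
  case (Suc n)
  have "tensor_mat f n * tensor_mat g n = tensor_mat (\<lambda>j. f j * g j) n"
    using Suc by auto
  moreover have "tensor_mat f n \<in> carrier_mat (2 ^ n) (2 ^ n)" "f (Suc n) \<in> carrier_mat 2 2"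
    "tensor_mat g n \<in> carrier_mat (2 ^ n) (2 ^ n)" "g (Suc n) \<in> carrier_mat 2 2"
    using Suc.prems by (auto intro!: tensor_mat_carrier)
  ultimately show ?case by (simp add: kron_mat_mult)
qed simp

text \<open>Two composite indices agree exactly when their quotients and remainders modulo 2 agree,
  so the Kronecker delta factors.\<close>

lemma tensor_mat_one: "tensor_mat (\<lambda>_. 1\<^sub>m 2) n = 1\<^sub>m (2 ^ n)"
proof (induction n)
  case (Suc n)
  have "kron_mat (1\<^sub>m (2 ^ n)) (1\<^sub>m 2) = 1\<^sub>m (2 ^ Suc n)"
  proof (rule eq_matI)
    fix i j :: nat assume "i < dim_row (1\<^sub>m (2 ^ Suc n))" "j < dim_col (1\<^sub>m (2 ^ Suc n))"
    moreover have "i = j \<longleftrightarrow> i div 2 = j div 2 \<and> i mod 2 = j mod 2"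
      by (metis div_mult_mod_eq)
    ultimately show "kron_mat (1\<^sub>m (2 ^ n)) (1\<^sub>m 2) $$ (i, j) = 1\<^sub>m (2 ^ Suc n) $$ (i, j)"
      by (auto simp: kron_mat_def)
  qed (auto simp: kron_mat_def)
  with Suc show ?case by simp
qed simp

section \<open>Pauli strings of identities and X matrices\<close>

text \<open>One formula for both matrices: the identity has its ones where \<open>i = j\<close>, and
  X (any \<open>m\<close> other than 0) where the indices differ.\<close>

lemma sigma_entries: "sigma m = mat 2 2 (\<lambda>(i, j). if (m = 0) = (i = j) then 1 else 0)"
  by (rule eq_matI) (auto simp: sigma_def mat_of_rows_list_def less_2_cases_iff)

lemma sigma_carrier: "sigma m \<in> carrier_mat 2 2"
  by (simp add: sigma_entries)

lemma hermitian_sigma: "hermitian_mat (sigma m)"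
  unfolding hermitian_mat_iff[OF sigma_carrier] by (auto simp: sigma_entries)

lemma sigma_square: "sigma m * sigma m = 1\<^sub>m 2"
proof (cases "m = 0")
  case False
  then have s: "sigma m = mat 2 2 (\<lambda>(i, j). if i = j then 0 else 1)"
    unfolding sigma_entries by (intro eq_matI) auto
  show ?thesis
    unfolding s by (rule eq_matI) (auto simp: scalar_prod_def numeral_2_eq_2)
qed (simp add: sigma_def)

text \<open>Only I and X occur, so either one factor is the identity or both factors
  coincide.\<close>

lemma sigma_commute: "sigma l * sigma m = sigma m * sigma l"
  using sigma_carrier[of l] sigma_carrier[of m] by (auto simp: sigma_def split: if_splits)

lemma pauli_string_carrier: "pauli_string N b \<in> carrier_mat (2 ^ N) (2 ^ N)"
  unfolding pauli_string_def by (rule tensor_mat_carrier) (rule sigma_carrier)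

lemma hermitian_pauli_string: "hermitian_mat (pauli_string N b)"
  unfolding pauli_string_def by (intro hermitian_tensor_mat sigma_carrier hermitian_sigma)

lemma pauli_string_square: "pauli_string N b * pauli_string N b = 1\<^sub>m (2 ^ N)"
  unfolding pauli_string_def
  by (simp add: tensor_mat_mult sigma_carrier sigma_square tensor_mat_one)

lemma pauli_string_commute:
  "pauli_string N b * pauli_string N b' = pauli_string N b' * pauli_string N b"
  unfolding pauli_string_def by (simp add: tensor_mat_mult sigma_carrier sigma_commute)

section \<open>Algebra of the operators \<open>ham_term\<close>\<close>

lemma ham_term_carrier: "ham_term N b h \<in> carrier_mat (2 ^ N) (2 ^ N)"
  unfolding ham_term_def using pauli_string_carrier by auto

lemma hermitian_ham_term: "hermitian_mat (ham_term N b h)"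
  using hermitian_pauli_string[of N b] pauli_string_carrier[of N b]
  unfolding hermitian_mat_iff[OF ham_term_carrier] hermitian_mat_iff[OF pauli_string_carrier]
  by (auto simp: ham_term_def)

lemma smult_smult_mat: "(x :: 'a :: semigroup_mult) \<cdot>\<^sub>m (y \<cdot>\<^sub>m A) = (x * y) \<cdot>\<^sub>m A"
  by (rule eq_matI) (auto simp: mult.assoc)

lemma smult_mat_mult_vec:
  "A \<in> carrier_mat r d \<Longrightarrow> v \<in> carrier_vec d \<Longrightarrow> ((c :: 'a :: comm_ring_1) \<cdot>\<^sub>m A) *\<^sub>v v = c \<cdot>\<^sub>v (A *\<^sub>v v)"
  by (rule eq_vecI) (auto simp: scalar_prod_def sum_distrib_left mult.assoc)

text \<open>Both factors have the shape of \<open>ham_term\<close>; this one expansion serves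
  commutation as well as squaring.\<close>

lemma affine_mat_mult:
  fixes A B :: "'a :: comm_ring_1 mat"
  assumes "A \<in> carrier_mat d d" "B \<in> carrier_mat d d"
  shows "(x \<cdot>\<^sub>m A + y \<cdot>\<^sub>m 1\<^sub>m d) * (z \<cdot>\<^sub>m B + w \<cdot>\<^sub>m 1\<^sub>m d)
    = (x * z) \<cdot>\<^sub>m (A * B) + (x * w) \<cdot>\<^sub>m A + (y * z) \<cdot>\<^sub>m B + (y * w) \<cdot>\<^sub>m 1\<^sub>m d"
proof -
  let ?I = "1\<^sub>m d :: 'a mat" and ?R = "z \<cdot>\<^sub>m B + w \<cdot>\<^sub>m 1\<^sub>m d"
  have c: "x \<cdot>\<^sub>m A \<in> carrier_mat d d" "y \<cdot>\<^sub>m ?I \<in> carrier_mat d d"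
    "z \<cdot>\<^sub>m B \<in> carrier_mat d d" "w \<cdot>\<^sub>m ?I \<in> carrier_mat d d" "?R \<in> carrier_mat d d"
    using assms by auto
  have "(x \<cdot>\<^sub>m A + y \<cdot>\<^sub>m ?I) * ?R = x \<cdot>\<^sub>m A * ?R + y \<cdot>\<^sub>m ?I * ?R"
    by (rule add_mult_distrib_mat[OF c(1,2,5)])
  also have "x \<cdot>\<^sub>m A * ?R = x \<cdot>\<^sub>m A * (z \<cdot>\<^sub>m B) + x \<cdot>\<^sub>m A * (w \<cdot>\<^sub>m ?I)"
    by (rule mult_add_distrib_mat[OF c(1,3,4)])
  also have "y \<cdot>\<^sub>m ?I * ?R = y \<cdot>\<^sub>m ?I * (z \<cdot>\<^sub>m B) + y \<cdot>\<^sub>m ?I * (w \<cdot>\<^sub>m ?I)"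
    by (rule mult_add_distrib_mat[OF c(2,3,4)])
  also have "x \<cdot>\<^sub>m A * (z \<cdot>\<^sub>m B) = (x * z) \<cdot>\<^sub>m (A * B)"
    using assms by (simp add: mult_smult_distrib[of _ d d _ d] mult_smult_assoc_mat[of _ d d _ d]
        mult.commute smult_smult_mat)
  also have "x \<cdot>\<^sub>m A * (w \<cdot>\<^sub>m ?I) = (x * w) \<cdot>\<^sub>m A"
    using assms by (simp add: mult_smult_distrib[of _ d d _ d] mult_smult_assoc_mat[of _ d d _ d]
        mult.commute smult_smult_mat)
  also have "y \<cdot>\<^sub>m ?I * (z \<cdot>\<^sub>m B) = (y * z) \<cdot>\<^sub>m B"
    using assms by (simp add: mult_smult_assoc_mat[of _ d d _ d] smult_smult_mat)
  also have "y \<cdot>\<^sub>m ?I * (w \<cdot>\<^sub>m ?I) = (y * w) \<cdot>\<^sub>m ?I"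
    by (simp add: mult_smult_assoc_mat[of _ d d _ d] smult_smult_mat)
  finally show ?thesis
    using assms by (simp add: assoc_add_mat[of _ d d])
qed

text \<open>Once the two Pauli strings commute, the expansions of the two products differ only in
  the order of the middle terms and of the scalars.\<close>

lemma ham_term_commute:
  "ham_term N b h * ham_term N b' h' = ham_term N b' h' * ham_term N b h"
  unfolding ham_term_def
    affine_mat_mult[OF pauli_string_carrier pauli_string_carrier]
    pauli_string_commute[of N b' b]
  using pauli_string_carrier[of N b] pauli_string_carrier[of N b']
  by (intro eq_matI) (auto simp: algebra_simps)

text \<open>With \<open>P * P = I\<close> and \<open>h * h = \<bar>h\<bar> * \<bar>h\<bar>\<close>,
  the square is \<open>2 h \<bar>h\<bar> P + 2 \<bar>h\<bar> \<bar>h\<bar> I\<close>, from which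
  \<open>2 \<bar>h\<bar>\<close> factors out.\<close>

lemma ham_term_square:
  "ham_term N b h * ham_term N b h = complex_of_real (2 * \<bar>h\<bar>) \<cdot>\<^sub>m ham_term N b h"
proof -
  have "h * h = \<bar>h\<bar> * \<bar>h\<bar>" by simp
  then have "complex_of_real h * complex_of_real h = complex_of_real \<bar>h\<bar> * complex_of_real \<bar>h\<bar>"
    by (metis of_real_mult)
  then show ?thesis
    unfolding ham_term_def affine_mat_mult[OF pauli_string_carrier pauli_string_carrier]
      pauli_string_square
    using pauli_string_carrier[of N b]
    by (intro eq_matI) (auto simp: algebra_simps)
qed

text \<open>Factoring \<open>h\<close> as \<open>\<bar>h\<bar> * sgn h\<close> exposes the
  controlled operator \<open>sgn h P\<close>. This is the form \<open>c \<cdot> (v + Q v)\<close> on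
  which the averaging over an ancilla relies.\<close>

lemma ham_term_mult_vec:
  assumes "v \<in> carrier_vec (2 ^ N)"
  shows "ham_term N b h *\<^sub>v v = complex_of_real \<bar>h\<bar> \<cdot>\<^sub>v
    (v + (complex_of_real (sgn h) \<cdot>\<^sub>m pauli_string N b) *\<^sub>v v)"
proof -
  have "complex_of_real h = complex_of_real \<bar>h\<bar> * complex_of_real (sgn h)"
    by (metis abs_mult_sgn of_real_mult)
  then have "ham_term N b h *\<^sub>v v = (complex_of_real \<bar>h\<bar> * complex_of_real (sgn h)) \<cdot>\<^sub>v
      (pauli_string N b *\<^sub>v v) + complex_of_real \<bar>h\<bar> \<cdot>\<^sub>v v"
    using assms pauli_string_carrier[of N b]
    by (simp add: ham_term_def add_mult_distrib_mat_vec[of _ "2 ^ N" "2 ^ N"]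
        smult_mat_mult_vec[of _ "2 ^ N" "2 ^ N"])
  moreover have "(complex_of_real (sgn h) \<cdot>\<^sub>m pauli_string N b) *\<^sub>v v
      = complex_of_real (sgn h) \<cdot>\<^sub>v (pauli_string N b *\<^sub>v v)"
    using assms by (rule smult_mat_mult_vec[OF pauli_string_carrier])
  moreover have "pauli_string N b *\<^sub>v v \<in> carrier_vec (2 ^ N)"
    using assms by (rule mult_mat_vec_carrier[OF pauli_string_carrier])
  ultimately show ?thesis
    using assms
    by (simp add: smult_add_distrib_vec[of _ "2 ^ N"] smult_smult_assoc comm_add_vec[of _ "2 ^ N" "_ \<cdot>\<^sub>v v"]
        del: carrier_vec_dim_vec)
qed

section \<open>Inner products, Hermitian operators and positivity\<close>

lemma braket_sum: "dim_vec u = dim_vec v \<Longrightarrow> braket u v = (\<Sum>i<dim_vec v. v $ i * cnj (u $ i))"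
  by (simp add: braket_def scalar_prod_def lessThan_atLeast0)

lemma braket_smult_right:
  "u \<in> carrier_vec d \<Longrightarrow> v \<in> carrier_vec d \<Longrightarrow> braket u (c \<cdot>\<^sub>v v) = c * braket u v"
  by (simp add: braket_sum sum_distrib_left mult.assoc)

lemma braket_add_right:
  "u \<in> carrier_vec d \<Longrightarrow> v \<in> carrier_vec d \<Longrightarrow> w \<in> carrier_vec d
    \<Longrightarrow> braket u (v + w) = braket u v + braket u w"
  by (simp add: braket_sum sum.distrib algebra_simps)

lemma braket_nonneg: "0 \<le> braket v v"
  unfolding braket_def by (rule conjugate_square_ge_0_vec)

text \<open>Swapping the double sum and replacing \<open>A $$ (i, j)\<close> by the conjugate of
  \<open>A $$ (j, i)\<close> moves the operator to the other argument.\<close>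

lemma braket_hermitian:
  assumes "A \<in> carrier_mat d d" "hermitian_mat A" "u \<in> carrier_vec d" "v \<in> carrier_vec d"
  shows "braket u (A *\<^sub>v v) = braket (A *\<^sub>v u) v"
proof -
  have "braket u (A *\<^sub>v v) = (\<Sum>i<d. \<Sum>j<d. A $$ (i, j) * v $ j * cnj (u $ i))"
    using assms
    by (auto simp: braket_sum scalar_prod_def lessThan_atLeast0 sum_distrib_right intro!: sum.cong)
  also have "\<dots> = (\<Sum>j<d. \<Sum>i<d. A $$ (i, j) * v $ j * cnj (u $ i))"
    by (rule sum.swap)
  also have "\<dots> = (\<Sum>j<d. \<Sum>i<d. v $ j * cnj (A $$ (j, i) * u $ i))"
    using assms(2) unfolding hermitian_mat_iff[OF assms(1)]
    by (intro sum.cong refl) (auto simp: mult_ac)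
  also have "\<dots> = braket (A *\<^sub>v u) v"
    using assms
    by (auto simp: braket_sum scalar_prod_def lessThan_atLeast0 sum_distrib_left intro!: sum.cong)
  finally show ?thesis .
qed

text \<open>The adjoint of \<open>A * B\<close> is \<open>B * A\<close> for Hermitian factors, which
  is \<open>A * B\<close> again by commutation.\<close>

lemma hermitian_mult_commute:
  assumes "A \<in> carrier_mat d d" "B \<in> carrier_mat d d" "hermitian_mat A" "hermitian_mat B"
    and "A * B = B * A"
  shows "hermitian_mat (A * B)"
proof -
  have "cnj ((B * A) $$ (j, i)) = (A * B) $$ (i, j)" if "i < d" "j < d" for i j
  proof -
    have "cnj (B $$ (j, k) * A $$ (k, i)) = A $$ (i, k) * B $$ (k, j)" if "k < d" for k
      using assms(3,4) \<open>i < d\<close> \<open>j < d\<close> that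
      unfolding hermitian_mat_iff[OF assms(1)] hermitian_mat_iff[OF assms(2)]
      by (simp add: mult.commute)
    then show ?thesis
      using assms(1,2) that by (auto simp: scalar_prod_def intro!: sum.cong)
  qed
  then show ?thesis
    using assms(5) by (subst hermitian_mat_iff[of _ d]) (use assms(1,2) in auto)
qed

text \<open>Under these hypotheses \<open>T / c\<close> is a Hermitian idempotent, so
  \<open>T\<close> is a positive multiple of an orthogonal projection.\<close>

lemma psd_of_square_eq_smult:
  assumes "T \<in> carrier_mat d d" "hermitian_mat T" "T * T = complex_of_real c \<cdot>\<^sub>m T" "c > 0"
  shows "positive_semidefinite T"
  unfolding positive_semidefinite_def
proof (intro conjI ballI)
  fix v :: "complex vec" assume "v \<in> carrier_vec (dim_row T)"
  then have v: "v \<in> carrier_vec d" and Tv: "T *\<^sub>v v \<in> carrier_vec d" using assms(1) by auto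
  have "complex_of_real c * braket v (T *\<^sub>v v) = braket v ((T * T) *\<^sub>v v)"
    unfolding assms(3) using v Tv assms(1)
    by (simp add: smult_mat_mult_vec[of _ d d] braket_smult_right[of _ d])
  also have "\<dots> = braket (T *\<^sub>v v) (T *\<^sub>v v)"
    using v Tv assms(1,2) by (simp add: assoc_mult_mat_vec[of _ d d _ d] braket_hermitian[of _ d])
  finally have "0 \<le> complex_of_real c * braket v (T *\<^sub>v v)" by (simp add: braket_nonneg)
  then show "0 \<le> braket v (T *\<^sub>v v)"
    using assms(4) by (auto simp: less_eq_complex_def zero_le_mult_iff)
qed (fact assms(2))

section \<open>Ordered products of commuting operators\<close>

lemma op_prod_carrier:
  "(\<And>k. k \<in> {1..n} \<Longrightarrow> F k \<in> carrier_mat d d) \<Longrightarrow> op_prod d F n \<in> carrier_mat d d"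
proof (induction n)
  case (Suc n)
  then have "F (Suc n) \<in> carrier_mat d d" "op_prod d F n \<in> carrier_mat d d" by auto
  then show ?case by simp
qed simp

lemma op_prod_commute:
  assumes "A \<in> carrier_mat d d" "\<And>k. k \<in> {1..n} \<Longrightarrow> F k \<in> carrier_mat d d"
    and "\<And>k. k \<in> {1..n} \<Longrightarrow> A * F k = F k * A"
  shows "A * op_prod d F n = op_prod d F n * A"
  using assms
proof (induction n)
  case (Suc n)
  define T where "T = op_prod d F n"
  have c: "F (Suc n) \<in> carrier_mat d d" "T \<in> carrier_mat d d"
    using Suc.prems unfolding T_def by (auto intro!: op_prod_carrier)
  have "A * (F (Suc n) * T) = F (Suc n) * A * T"
    using Suc.prems(3)[of "Suc n"] assoc_mult_mat[OF assms(1) c] by simp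
  also have "\<dots> = F (Suc n) * (T * A)"
    using Suc assoc_mult_mat[OF c(1) assms(1) c(2)] by (simp add: T_def)
  also have "\<dots> = F (Suc n) * T * A"
    using assoc_mult_mat[OF c assms(1)] by simp
  finally show ?case by (simp add: T_def)
qed simp

text \<open>The newest factor commutes with the whole product of the earlier ones, so
  \<open>hermitian_mult_commute\<close> applies at each step.\<close>

lemma op_prod_hermitian:
  assumes "\<And>k. k \<in> {1..n} \<Longrightarrow> F k \<in> carrier_mat d d"
    and "\<And>k. k \<in> {1..n} \<Longrightarrow> hermitian_mat (F k)"
    and "\<And>j k. j \<in> {1..n} \<Longrightarrow> k \<in> {1..n} \<Longrightarrow> F j * F k = F k * F j"
  shows "hermitian_mat (op_prod d F n)"
  using assms
proof (induction n)
  case (Suc n)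
  then have "hermitian_mat (op_prod d F n)" by auto
  moreover have "F (Suc n) * op_prod d F n = op_prod d F n * F (Suc n)"
    using Suc.prems by (intro op_prod_commute) auto
  ultimately show ?case
    using Suc.prems by (auto intro!: hermitian_mult_commute[of _ d] op_prod_carrier)
qed (simp add: hermitian_one_mat)

text \<open>Commutation regroups the square of \<open>A * T\<close> as
  \<open>A * A * (T * T)\<close>, so the scalars of the individual factors multiply.\<close>

lemma op_prod_square:
  assumes "\<And>k. k \<in> {1..n} \<Longrightarrow> F k \<in> carrier_mat d d"
    and "\<And>k. k \<in> {1..n} \<Longrightarrow> F k * F k = c k \<cdot>\<^sub>m F k"
    and "\<And>j k. j \<in> {1..n} \<Longrightarrow> k \<in> {1..n} \<Longrightarrow> F j * F k = F k * F j"
  shows "op_prod d F n * op_prod d F n = (\<Prod>k=1..n. c k) \<cdot>\<^sub>m op_prod d F n"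
  using assms
proof (induction n)
  case 0
  show ?case by (intro eq_matI) auto
next
  case (Suc n)
  define T where "T = op_prod d F n"
  define A where "A = F (Suc n)"
  have c: "A \<in> carrier_mat d d" "T \<in> carrier_mat d d" "T * A \<in> carrier_mat d d"
    using Suc.prems unfolding T_def A_def by (auto intro!: op_prod_carrier mult_carrier_mat)
  have comm: "A * T = T * A"
    unfolding T_def A_def using Suc.prems by (intro op_prod_commute) auto
  have A: "A * A = c (Suc n) \<cdot>\<^sub>m A" using Suc.prems unfolding A_def by auto
  have T: "T * T = (\<Prod>k=1..n. c k) \<cdot>\<^sub>m T" using Suc unfolding T_def by auto
  have "A * T * (A * T) = A * (T * A * T)"
    using assoc_mult_mat[OF c(1,2)] assoc_mult_mat[OF c(2,1)] c by (metis mult_carrier_mat)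
  \<comment> \<open>The inner \<open>T * A\<close> is exchanged for \<open>A * T\<close>; the rest
    is reassociation.\<close>
  also have "\<dots> = A * A * (T * T)"
    unfolding comm[symmetric]
    using assoc_mult_mat[OF c(1,1)] assoc_mult_mat[OF c(1,2)] c by (metis mult_carrier_mat)
  also have "\<dots> = (\<Prod>k=1..Suc n. c k) \<cdot>\<^sub>m (A * T)"
    unfolding A T using c
    by (simp add: mult_smult_distrib[of _ d d _ d] mult_smult_assoc_mat[of _ d d _ d]
        smult_smult_mat mult.commute)
  finally show ?case by (simp add: A_def T_def)
qed

text \<open>The recursion of \<open>op_prod\<close> exposes the leftmost factor, which acts last. An
  induction that follows the action on a vector needs the factor acting first, at the price of
  shifted indices.\<close>

lemma op_prod_Suc_right:
  assumes "\<And>k. k \<in> {1..Suc n} \<Longrightarrow> F k \<in> carrier_mat d d"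
  shows "op_prod d F (Suc n) = op_prod d (\<lambda>k. F (Suc k)) n * F 1"
  using assms
proof (induction n)
  case (Suc n)
  have "op_prod d F (Suc (Suc n)) = F (Suc (Suc n)) * (op_prod d (\<lambda>k. F (Suc k)) n * F 1)"
    using Suc by simp
  also have "\<dots> = F (Suc (Suc n)) * op_prod d (\<lambda>k. F (Suc k)) n * F 1"
    using Suc.prems by (intro assoc_mult_mat[symmetric, of _ d d _ d _ d] op_prod_carrier) auto
  finally show ?case by simp
qed simp

section \<open>Overlaps and linearity of product vectors\<close>

lemma braket_kron:
  assumes "u \<in> carrier_vec r" "v \<in> carrier_vec r" "x \<in> carrier_vec s" "y \<in> carrier_vec s"
  shows "braket (kron_vec u x) (kron_vec v y) = braket u v * braket x y"
proof -
  have "braket (kron_vec u x) (kron_vec v y)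
      = (\<Sum>i<r * s. (v $ (i div s) * cnj (u $ (i div s))) * (y $ (i mod s) * cnj (x $ (i mod s))))"
    using assms by (auto simp: braket_sum kron_vec_def intro!: sum.cong)
  also have "\<dots> = (\<Sum>i<r. v $ i * cnj (u $ i)) * (\<Sum>i<s. y $ i * cnj (x $ i))"
    by (rule sum_div_mod)
  finally show ?thesis using assms by (simp add: braket_sum)
qed

lemma braket_tensor:
  assumes "\<And>j. j \<in> {1..n} \<Longrightarrow> f j \<in> carrier_vec 2" "\<And>j. j \<in> {1..n} \<Longrightarrow> g j \<in> carrier_vec 2"
  shows "braket (tensor_vec f n) (tensor_vec g n) = (\<Prod>j=1..n. braket (f j) (g j))"
  using assms
proof (induction n)
  case (Suc n)
  then have "braket (tensor_vec f n) (tensor_vec g n) = (\<Prod>j=1..n. braket (f j) (g j))" by auto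
  moreover have "tensor_vec f n \<in> carrier_vec (2 ^ n)" "tensor_vec g n \<in> carrier_vec (2 ^ n)"
    "f (Suc n) \<in> carrier_vec 2" "g (Suc n) \<in> carrier_vec 2"
    using Suc.prems by (auto intro!: tensor_vec_carrier)
  ultimately show ?case by (simp add: braket_kron)
qed (simp add: braket_sum)

text \<open>The combination \<open>c \<cdot>\<^sub>v (x + y)\<close> is chosen to match the
  definition of \<open>ket_plus\<close>.\<close>

lemma kron_vec_linear:
  assumes "x \<in> carrier_vec s" "y \<in> carrier_vec s"
  shows "kron_vec v (c \<cdot>\<^sub>v (x + y)) = c \<cdot>\<^sub>v (kron_vec v x + kron_vec v y)"
    and "kron_vec (c \<cdot>\<^sub>v (x + y)) v = c \<cdot>\<^sub>v (kron_vec x v + kron_vec y v)"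
proof -
  \<comment> \<open>The remainder modulo \<open>s\<close> is a valid index only for
    \<open>s > 0\<close>; for \<open>s = 0\<close> all the Kronecker products are empty.\<close>
  show "kron_vec v (c \<cdot>\<^sub>v (x + y)) = c \<cdot>\<^sub>v (kron_vec v x + kron_vec v y)"
    using assms by (cases "s = 0") (auto simp: kron_vec_def algebra_simps intro!: eq_vecI)
  show "kron_vec (c \<cdot>\<^sub>v (x + y)) v = c \<cdot>\<^sub>v (kron_vec x v + kron_vec y v)"
    using assms
    by (auto simp: kron_vec_def algebra_simps less_mult_imp_div_less intro!: eq_vecI)
qed

text \<open>Lets a \<open>ket_plus\<close> in slot \<open>k\<close> be split into its
  \<open>ket0\<close> and \<open>ket1\<close> parts while all other slots stay fixed.\<close>

lemma tensor_vec_linear: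
  assumes "\<And>j. j \<in> {1..n} \<Longrightarrow> w j \<in> carrier_vec 2" "k \<in> {1..n}"
    and "x \<in> carrier_vec 2" "y \<in> carrier_vec 2"
  shows "tensor_vec (w(k := c \<cdot>\<^sub>v (x + y))) n
    = c \<cdot>\<^sub>v (tensor_vec (w(k := x)) n + tensor_vec (w(k := y)) n)"
  using assms
proof (induction n)
  case (Suc n)
  show ?case
  proof (cases "k = Suc n")
    case True
    then have "tensor_vec (w(k := z)) n = tensor_vec w n" for z
      by (intro tensor_vec_cong) auto
    with True Suc.prems(3,4) show ?thesis
      by (simp add: fun_upd_def kron_vec_linear(1)[of _ 2])
  next
    case False
    then have IH: "tensor_vec (w(k := c \<cdot>\<^sub>v (x + y))) n
        = c \<cdot>\<^sub>v (tensor_vec (w(k := x)) n + tensor_vec (w(k := y)) n)"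
      by (intro Suc.IH) (use Suc.prems in auto)
    have "tensor_vec (w(k := z)) n \<in> carrier_vec (2 ^ n)" if "z \<in> carrier_vec 2" for z
      using Suc.prems that by (intro tensor_vec_carrier) auto
    with False Suc.prems IH show ?thesis by (simp add: fun_upd_def kron_vec_linear(2)[of _ "2 ^ n"])
  qed
qed simp

section \<open>Averaging controlled operators over the ancillas\<close>

lemma ket_plus_carrier: "ket_plus \<in> carrier_vec 2"
  by (simp add: ket_plus_def ket_carrier)

lemma braket_ket_plus:
  "braket ket_plus ket_plus = 1"
  "braket ket_plus ket0 = complex_of_real (1 / sqrt 2)"
  "braket ket_plus ket1 = complex_of_real (1 / sqrt 2)"
  by (auto simp: braket_sum ket_plus_def ket0_def ket1_def numeral_2_eq_2 simp flip: of_real_mult)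

text \<open>Induction peels the rightmost operator off the product: it acts on a product vector, where
  it splits \<open>|+\<rangle>\<close> at its own ancilla into two product vectors that carry \<open>|0\<rangle>\<close> and \<open>|1\<rangle>\<close> there.
  Hence the ancillas \<open>j \<le> m\<close> of the vector must be arbitrary.\<close>

lemma braket_controlled_op_prod:
  assumes "\<And>k. k \<in> {1..n} \<Longrightarrow> is_controlled_op a n (Q k) k (U k)"
    and "\<And>k. k \<in> {1..n} \<Longrightarrow> Q k \<in> carrier_mat a a"
    and "\<And>k. k \<in> {1..n} \<Longrightarrow> G k \<in> carrier_mat a a"
    and "\<And>k v. k \<in> {1..n} \<Longrightarrow> v \<in> carrier_vec a \<Longrightarrow> G k *\<^sub>v v = c k \<cdot>\<^sub>v (v + Q k *\<^sub>v v)"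
    and "\<alpha> \<in> carrier_vec a" "v \<in> carrier_vec a"
    and "\<And>j. j \<in> {1..n} \<Longrightarrow> w j \<in> carrier_vec 2"
    and "\<And>j. j \<in> {m<..n} \<Longrightarrow> w j = ket_plus"
    and "m + l = n"
  shows "(\<Prod>k=1..l. 2 * c (k + m)) *
      braket (psi_state n \<alpha>)
        (op_prod (a * 2 ^ n) (\<lambda>k. U (k + m)) l *\<^sub>v kron_vec v (tensor_vec w n))
    = (\<Prod>j=1..n. braket ket_plus (w j)) * braket \<alpha> (op_prod a (\<lambda>k. G (k + m)) l *\<^sub>v v)"
  using assms(6-9)
proof (induction l arbitrary: m v w)
  case 0
  then show ?case
    using assms(5) kron_vec_carrier[OF 0(1) tensor_vec_carrier[of n w]]
      tensor_vec_carrier[of n "\<lambda>_. ket_plus"] tensor_vec_carrier[of n w]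
      braket_tensor[of n "\<lambda>_. ket_plus" w]
    by (simp add: psi_state_def braket_kron ket_plus_carrier)
next
  case (Suc l)
  let ?r = "complex_of_real (1 / sqrt 2)" and ?k = "Suc m" and ?d = "a * 2 ^ n"
  let ?W = "op_prod ?d (\<lambda>k. U (k + ?k)) l" and ?V = "op_prod a (\<lambda>k. G (k + ?k)) l"
  let ?w0 = "w(?k := ket0)" and ?w1 = "w(?k := ket1)"
  let ?x0 = "kron_vec v (tensor_vec ?w0 n)" and ?x1 = "kron_vec (Q ?k *\<^sub>v v) (tensor_vec ?w1 n)"
  let ?p = "\<Prod>j\<in>{1..n} - {?k}. braket ket_plus (w j)" and ?C = "\<Prod>k=1..l. 2 * c (k + ?k)"
  note v = Suc.prems(1) and w = Suc.prems(2)
  have k: "?k \<in> {1..n}" using Suc.prems(4) by auto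
  have Uc: "U k \<in> carrier_mat ?d ?d" if "k \<in> {1..n}" for k
    using assms(1)[OF that] by (simp add: is_controlled_op_def)
  have W: "?W \<in> carrier_mat ?d ?d" using Suc.prems(4) by (intro op_prod_carrier Uc) auto
  have V: "?V \<in> carrier_mat a a" using Suc.prems(4) by (intro op_prod_carrier assms(3)) auto
  have Qv: "Q ?k *\<^sub>v v \<in> carrier_vec a" using assms(2)[OF k] v by auto
  have w': "?w0 j \<in> carrier_vec 2" "?w1 j \<in> carrier_vec 2" if "j \<in> {1..n}" for j
    using w[OF that] by (auto simp: ket_carrier)
  have t: "tensor_vec ?w0 n \<in> carrier_vec (2 ^ n)" "tensor_vec ?w1 n \<in> carrier_vec (2 ^ n)"
    using w' by (blast intro: tensor_vec_carrier)+
  have x: "?x0 \<in> carrier_vec ?d" "?x1 \<in> carrier_vec ?d"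
    "kron_vec v (tensor_vec ?w1 n) \<in> carrier_vec ?d"
    using v Qv t by (auto intro: kron_vec_carrier)
  have psi: "psi_state n \<alpha> \<in> carrier_vec ?d"
    unfolding psi_state_def using assms(5)
    by (intro kron_vec_carrier tensor_vec_carrier ket_plus_carrier)
  \<comment> \<open>Slot \<open>Suc m\<close> lies in \<open>{m<..n}\<close>, hence still holds
    \<open>ket_plus\<close>, and the update rewrites it with its own value.\<close>
  have wk: "w(?k := ?r \<cdot>\<^sub>v (ket0 + ket1)) = w"
    using Suc.prems(3)[of ?k] k by (auto simp: ket_plus_def)
  have "kron_vec v (tensor_vec w n) = ?r \<cdot>\<^sub>v (?x0 + kron_vec v (tensor_vec ?w1 n))"
    using tensor_vec_linear[of n w ?k ket0 ket1 ?r, OF w k ket_carrier]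
      kron_vec_linear(1)[OF t] unfolding wk by simp
  \<comment> \<open>Both components are product vectors with a basis state in slot
    \<open>?k\<close>, where \<open>is_controlled_op\<close> prescribes the action.\<close>
  moreover have "U ?k *\<^sub>v ?x0 = ?x0" "U ?k *\<^sub>v kron_vec v (tensor_vec ?w1 n) = ?x1"
    using assms(1)[OF k] v w unfolding is_controlled_op_def by blast+
  ultimately have "U ?k *\<^sub>v kron_vec v (tensor_vec w n) = ?r \<cdot>\<^sub>v (?x0 + ?x1)"
    using Uc[OF k] x
    by (simp add: mult_mat_vec[of _ ?d ?d] mult_add_distrib_mat_vec[of _ ?d ?d])
  moreover have "op_prod ?d (\<lambda>k. U (k + m)) (Suc l) = ?W * U ?k"
    by (subst op_prod_Suc_right, rule Uc) (use Suc.prems(4) in auto)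
  ultimately have "op_prod ?d (\<lambda>k. U (k + m)) (Suc l) *\<^sub>v kron_vec v (tensor_vec w n)
      = ?r \<cdot>\<^sub>v (?W *\<^sub>v ?x0 + ?W *\<^sub>v ?x1)"
    using W Uc[OF k] x kron_vec_carrier[OF v tensor_vec_carrier[of n w, OF w]]
    by (simp add: assoc_mult_mat_vec[of _ ?d ?d _ ?d] mult_mat_vec[of _ ?d ?d]
        mult_add_distrib_mat_vec[of _ ?d ?d])
  then have L: "braket (psi_state n \<alpha>)
        (op_prod ?d (\<lambda>k. U (k + m)) (Suc l) *\<^sub>v kron_vec v (tensor_vec w n))
      = ?r * (braket (psi_state n \<alpha>) (?W *\<^sub>v ?x0) + braket (psi_state n \<alpha>) (?W *\<^sub>v ?x1))"
    using W x psi
    by (simp add: braket_smult_right[of _ ?d] braket_add_right[of _ ?d] mult_mat_vec_carrier[of _ ?d ?d])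
  \<comment> \<open>Isolates the overlap at slot \<open>?k\<close>; the remaining factor
    \<open>?p\<close> is common to \<open>w\<close>, \<open>?w0\<close> and
    \<open>?w1\<close>.\<close>
  have p: "(\<Prod>j=1..n. braket ket_plus (f j))
      = braket ket_plus (f ?k) * (\<Prod>j\<in>{1..n} - {?k}. braket ket_plus (f j))" for f
    using k by (intro prod.remove) auto
  have p01: "(\<Prod>j=1..n. braket ket_plus (?w0 j)) = ?r * ?p"
    "(\<Prod>j=1..n. braket ket_plus (?w1 j)) = ?r * ?p"
    unfolding p by (auto simp: braket_ket_plus intro!: prod.cong)
  have pw: "(\<Prod>j=1..n. braket ket_plus (w j)) = ?p"
    unfolding p using Suc.prems(3)[of ?k] k by (simp add: braket_ket_plus)
  \<comment> \<open>The induction hypothesis is used at \<open>Suc m\<close>: slot \<open>?k\<close>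
    now holds a basis state, but only the slots beyond it must be \<open>ket_plus\<close>. Its
    overlap with \<open>ket_plus\<close> supplies the factor \<open>?r\<close>.\<close>
  have IH0: "?C * braket (psi_state n \<alpha>) (?W *\<^sub>v ?x0) = ?r * ?p * braket \<alpha> (?V *\<^sub>v v)"
    unfolding p01(1)[symmetric]
    by (rule Suc.IH[OF v w'(1)]) (use Suc.prems(3,4) in auto)
  have IH1: "?C * braket (psi_state n \<alpha>) (?W *\<^sub>v ?x1)
      = ?r * ?p * braket \<alpha> (?V *\<^sub>v (Q ?k *\<^sub>v v))"
    unfolding p01(2)[symmetric]
    by (rule Suc.IH[OF Qv w'(2)]) (use Suc.prems(3,4) in auto)
  have "op_prod a (\<lambda>k. G (k + m)) (Suc l) = ?V * G ?k"
    by (subst op_prod_Suc_right, rule assms(3)) (use Suc.prems(4) in auto)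
  then have "op_prod a (\<lambda>k. G (k + m)) (Suc l) *\<^sub>v v
      = c ?k \<cdot>\<^sub>v (?V *\<^sub>v v + ?V *\<^sub>v (Q ?k *\<^sub>v v))"
    using V assms(3)[OF k] v Qv
    by (simp add: assoc_mult_mat_vec[of _ a a _ a] assms(4)[OF k] mult_mat_vec[of _ a a]
        mult_add_distrib_mat_vec[of _ a a])
  then have R: "braket \<alpha> (op_prod a (\<lambda>k. G (k + m)) (Suc l) *\<^sub>v v)
      = c ?k * (braket \<alpha> (?V *\<^sub>v v) + braket \<alpha> (?V *\<^sub>v (Q ?k *\<^sub>v v)))"
    using V v Qv assms(5)
    by (simp add: braket_smult_right[of _ a] braket_add_right[of _ a] mult_mat_vec_carrier[of _ a a])
  have C: "(\<Prod>k=1..Suc l. 2 * c (k + m)) = 2 * c ?k * ?C"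
    by (subst prod.atLeast_Suc_atMost)
      (simp_all add: prod.shift_bounds_cl_Suc_ivl del: prod.cl_ivl_Suc)
  have rr: "?r * ?r = 1 / 2" by (simp flip: of_real_mult)
  \<comment> \<open>One \<open>?r\<close> comes from splitting \<open>ket_plus\<close>, the other
    from the overlap of the basis state with \<open>ket_plus\<close>; their product 1/2 cancels the
    2 attached to \<open>c ?k\<close>.\<close>
  have "2 * c ?k * ?C * (?r * (braket (psi_state n \<alpha>) (?W *\<^sub>v ?x0) + braket (psi_state n \<alpha>) (?W *\<^sub>v ?x1)))
      = 2 * c ?k * ?r * (?C * braket (psi_state n \<alpha>) (?W *\<^sub>v ?x0) + ?C * braket (psi_state n \<alpha>) (?W *\<^sub>v ?x1))"
    by (simp add: algebra_simps)
  also have "\<dots> = 2 * (?r * ?r) * (?p * (c ?k * (braket \<alpha> (?V *\<^sub>v v) + braket \<alpha> (?V *\<^sub>v (Q ?k *\<^sub>v v)))))"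
    unfolding IH0 IH1 by (simp only: algebra_simps)
  also have "\<dots> = ?p * (c ?k * (braket \<alpha> (?V *\<^sub>v v) + braket \<alpha> (?V *\<^sub>v (Q ?k *\<^sub>v v))))"
    unfolding rr by simp
  finally show ?case unfolding L R C pw .
qed

theorem mainTheorem2:
  fixes N n :: nat
    and b :: "nat \<Rightarrow> nat \<Rightarrow> nat"
    and h :: "nat \<Rightarrow> real"
  defines "H \<equiv> \<lambda>k. ham_term N (b k) (h k)"
  assumes "N \<ge> 1"
    and "\<forall>k\<in>{1..n}. \<forall>i\<in>{1..N}. b k i \<in> {0, 1}"
    and "\<forall>k\<in>{1..n}. h k \<noteq> 0"
  shows "(\<forall>j\<in>{1..n}. \<forall>k\<in>{1..n}. H j * H k = H k * H j) \<and>
    hermitian_mat (op_prod (2 ^ N) H n) \<and>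
    positive_semidefinite (op_prod (2 ^ N) H n) \<and>
    (\<forall>\<alpha>\<in>carrier_vec (2 ^ N). braket \<alpha> \<alpha> = 1 \<longrightarrow>
       0 \<le> braket \<alpha> (op_prod (2 ^ N) H n *\<^sub>v \<alpha>)) \<and>
    (\<forall>\<alpha>\<in>carrier_vec (2 ^ N). braket \<alpha> \<alpha> = 1 \<longrightarrow>
       (\<forall>U :: nat \<Rightarrow> complex mat.
          (\<forall>k\<in>{1..n}. is_controlled_op (2 ^ N) n
             (complex_of_real (sgn (h k)) \<cdot>\<^sub>m pauli_string N (b k)) k (U k)) \<longrightarrow>
          braket (psi_state n \<alpha>) (op_prod (2 ^ N * 2 ^ n) U n *\<^sub>v psi_state n \<alpha>)
            = braket \<alpha> (op_prod (2 ^ N) H n *\<^sub>v \<alpha>)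
              / complex_of_real (2 ^ n * \<bar>\<Prod>k=1..n. h k\<bar>)))"
proof -
  let ?d = "2 ^ N :: nat"
  let ?T = "op_prod ?d H n" and ?Q = "\<lambda>k. complex_of_real (sgn (h k)) \<cdot>\<^sub>m pauli_string N (b k)"
  let ?c = "2 ^ n * \<bar>\<Prod>k=1..n. h k\<bar>"
  have Hc: "H k \<in> carrier_mat ?d ?d" for k unfolding H_def by (rule ham_term_carrier)
  have comm: "H j * H k = H k * H j" for j k unfolding H_def by (rule ham_term_commute)
  have T: "?T \<in> carrier_mat ?d ?d" by (intro op_prod_carrier Hc)
  have herm: "hermitian_mat ?T"
    by (intro op_prod_hermitian Hc comm) (simp add: H_def hermitian_ham_term)
  \<comment> \<open>Since every \<open>h k\<close> is nonzero, \<open>?c\<close> is positive. It is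
    both the scalar in \<open>?T * ?T = ?c \<cdot> ?T\<close> and the denominator of the claimed
    expectation value.\<close>
  have cpos: "?c > 0" using assms(4) by auto
  have c: "(\<Prod>k=1..n. complex_of_real (2 * \<bar>h k\<bar>)) = complex_of_real ?c"
    by (simp add: prod.distrib abs_prod)
  have "?T * ?T = (\<Prod>k=1..n. complex_of_real (2 * \<bar>h k\<bar>)) \<cdot>\<^sub>m ?T"
    by (rule op_prod_square) (use Hc comm in \<open>auto simp: H_def ham_term_square\<close>)
  then have psd: "positive_semidefinite ?T"
    unfolding c by (rule psd_of_square_eq_smult[OF T herm _ cpos])
  then have nonneg: "0 \<le> braket \<alpha> (?T *\<^sub>v \<alpha>)" if "\<alpha> \<in> carrier_vec ?d" for \<alpha>
    using that T unfolding positive_semidefinite_def by auto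
  have "braket (psi_state n \<alpha>) (op_prod (?d * 2 ^ n) U n *\<^sub>v psi_state n \<alpha>)
      = braket \<alpha> (?T *\<^sub>v \<alpha>) / complex_of_real ?c"
    if "\<alpha> \<in> carrier_vec ?d" "\<forall>k\<in>{1..n}. is_controlled_op ?d n (?Q k) k (U k)" for \<alpha> U
  proof -
    \<comment> \<open>The general lemma at \<open>m = 0\<close> and \<open>l = n\<close>, with
      \<open>ket_plus\<close> in every slot and \<open>c k = \<bar>h k\<bar>\<close>. The summands
      \<open>+ 0\<close> keep the shape of its index shift.\<close>
    have "(\<Prod>k=1..n. 2 * complex_of_real \<bar>h (k + 0)\<bar>) *
        braket (psi_state n \<alpha>)
          (op_prod (?d * 2 ^ n) (\<lambda>k. U (k + 0)) n *\<^sub>v kron_vec \<alpha> (tensor_vec (\<lambda>_. ket_plus) n))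
      = (\<Prod>j=1..n. braket ket_plus ket_plus) * braket \<alpha> (op_prod ?d (\<lambda>k. H (k + 0)) n *\<^sub>v \<alpha>)"
      by (rule braket_controlled_op_prod[where Q = ?Q])
        (use that pauli_string_carrier Hc in
          \<open>auto simp: ket_plus_carrier H_def ham_term_mult_vec\<close>)
    then have "complex_of_real ?c *
        braket (psi_state n \<alpha>) (op_prod (?d * 2 ^ n) U n *\<^sub>v psi_state n \<alpha>) = braket \<alpha> (?T *\<^sub>v \<alpha>)"
      using c by (simp add: braket_ket_plus flip: psi_state_def)
    \<comment> \<open>The identity is available in multiplied-out form, so dividing by
      \<open>?c\<close> gives the quotient.\<close>
    moreover have "complex_of_real ?c \<noteq> 0" using cpos by (simp only: of_real_eq_0_iff)
    ultimately show ?thesis by (metis nonzero_mult_div_cancel_left)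
  qed
  with comm herm psd nonneg show ?thesis by blast
qed

end
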